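(* Let $0<a_1\le\dots\le a_n$ and $1\le k\le n$. There exist continuous maps $f: T_{a_1,\ldots,a_n} \to \mathbb{R}^k$ such that for every $y\in\mathbb{R}^k$ the $(n-k)$-dimensional volume of the fiber $f^{-1}(y)$ is at most $2\prod_{i=1}^{n-k} a_i$.
   Context: $T_{a_1,\ldots,a_n}=\mathbb{R}^n/(a_1\mathbb{Z}\times\dots\times a_n\mathbb{Z})$ is the orthogonal flat torus with the flat metric induced from $\mathbb{R}^n$; the sizes are ordered $a_1\le\dots\le a_n$. The $(n-k)$-dimensional volume is the $(n-k)$-dimensional Riemannian volume (equivalently, normalized Hausdorff measure). *)

theory Defs
  imports "HOL-Analysis.Analysis"
begin

text \<open>
  \<open>\<real>\<^sup>n\<close> is the library's \<^const>\<open>Euclidean_space\<close> \<open>n\<close>: its points are the functions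
  \<open>x :: nat \<Rightarrow> real\<close> vanishing outside \<open>{..<n}\<close>. Coordinates and the side lengths \<open>a\<close> are indexed
  from \<open>0\<close>, so \<open>a 0, \<dots>, a (n - 1)\<close> stand for \<open>a\<^sub>1, \<dots>, a\<^sub>n\<close>.
\<close>

definition lattice_rel :: "nat \<Rightarrow> (nat \<Rightarrow> real) \<Rightarrow> ((nat \<Rightarrow> real) \<times> (nat \<Rightarrow> real)) set" where
  "lattice_rel n a =
     {(x, y). x \<in> topspace (Euclidean_space n) \<and> y \<in> topspace (Euclidean_space n) \<and>
              (\<forall>i<n. \<exists>m::int. x i - y i = a i * of_int m)}"

definition flat_torus :: "nat \<Rightarrow> (nat \<Rightarrow> real) \<Rightarrow> (nat \<Rightarrow> real) set set" where
  "flat_torus n a = topspace (Euclidean_space n) // lattice_rel n a"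

text \<open>
  The Riemannian distance of the flat metric: the infimum of the Euclidean distances between
  representatives. It makes sense for any two sets of points, so \<open>a\<close> is not an argument; the value
  for an empty set is chosen so that the distance is nonnegative everywhere, as
  \<^locale>\<open>Metric_space\<close> demands.
\<close>

definition flat_dist :: "nat \<Rightarrow> (nat \<Rightarrow> real) set \<Rightarrow> (nat \<Rightarrow> real) set \<Rightarrow> real" where
  "flat_dist n P Q =
     (if P = {} \<or> Q = {} then 0
      else Inf {L2_set (\<lambda>i. x i - y i) {..<n} | x y. x \<in> P \<and> y \<in> Q})"

abbreviation flat_torus_topology :: "nat \<Rightarrow> (nat \<Rightarrow> real) \<Rightarrow> (nat \<Rightarrow> real) set topology" where
  "flat_torus_topology n a \<equiv> Metric_space.mtopology (flat_torus n a) (flat_dist n)"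

lemma lattice_relD:
  assumes "(x, y) \<in> lattice_rel n a" "i < n"
  shows "\<exists>m::int. x i - y i = a i * of_int m"
  using assms by (simp add: lattice_rel_def)

lemma equiv_lattice_rel: "equiv (topspace (Euclidean_space n)) (lattice_rel n a)"
proof (intro equivI)
  show "lattice_rel n a \<subseteq> topspace (Euclidean_space n) \<times> topspace (Euclidean_space n)"
    by (auto simp: lattice_rel_def)
  show "refl_on (topspace (Euclidean_space n)) (lattice_rel n a)"
    unfolding refl_on_def lattice_rel_def by (auto intro!: exI[of _ 0])
  show "sym (lattice_rel n a)"
  proof (rule symI)
    fix x y assume xy: "(x, y) \<in> lattice_rel n a"
    have "\<exists>m::int. y i - x i = a i * of_int m" if "i < n" for i
    proof -
      obtain m :: int where "x i - y i = a i * of_int m"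
        using lattice_relD[OF xy \<open>i < n\<close>] by blast
      then have "y i - x i = a i * of_int (- m)" by simp
      then show ?thesis by blast
    qed
    then show "(y, x) \<in> lattice_rel n a"
      using xy by (auto simp: lattice_rel_def)
  qed
  show "trans (lattice_rel n a)"
  proof (rule transI)
    fix x y z assume xy: "(x, y) \<in> lattice_rel n a" and yz: "(y, z) \<in> lattice_rel n a"
    have "\<exists>m::int. x i - z i = a i * of_int m" if "i < n" for i
    proof -
      obtain m m' :: int where "x i - y i = a i * of_int m" "y i - z i = a i * of_int m'"
        using lattice_relD[OF xy \<open>i < n\<close>] lattice_relD[OF yz \<open>i < n\<close>] by blast
      then have "x i - z i = a i * of_int (m + m')" by (simp add: algebra_simps)
      then show ?thesis by blast
    qed
    then show "(x, z) \<in> lattice_rel n a"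
      using xy yz by (auto simp: lattice_rel_def)
  qed
qed

lemma flat_dist_le:
  assumes "x \<in> P" "y \<in> Q"
  shows "flat_dist n P Q \<le> L2_set (\<lambda>i. x i - y i) {..<n}"
proof -
  have "bdd_below {L2_set (\<lambda>i. x i - y i) {..<n} | x y. x \<in> P \<and> y \<in> Q}"
    by (auto intro!: bdd_belowI[of _ 0])
  then show ?thesis
    unfolding flat_dist_def using assms by (auto intro!: cInf_lower)
qed

lemma flat_dist_greatest:
  assumes "P \<noteq> {}" "Q \<noteq> {}"
    and "\<And>x y. x \<in> P \<Longrightarrow> y \<in> Q \<Longrightarrow> c \<le> L2_set (\<lambda>i. x i - y i) {..<n}"
  shows "c \<le> flat_dist n P Q"
  unfolding flat_dist_def using assms by (auto intro!: cInf_greatest)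

lemma flat_dist_approx:
  assumes "P \<noteq> {}" "Q \<noteq> {}" "e > 0"
  obtains x y where "x \<in> P" "y \<in> Q" "L2_set (\<lambda>i. x i - y i) {..<n} < flat_dist n P Q + e"
  using flat_dist_greatest[OF assms(1,2), of "flat_dist n P Q + e" n] assms(3)
  by (meson add_le_same_cancel1 linorder_not_le)

lemma Metric_space_flat_torus:
  assumes a: "\<And>i. i < n \<Longrightarrow> 0 < a i"
  shows "Metric_space (flat_torus n a) (flat_dist n)"
proof
  note eq = equiv_lattice_rel[of n a]
  have rel: "(x, y) \<in> lattice_rel n a" if "P \<in> flat_torus n a" "x \<in> P" "y \<in> P" for P x y
    using that quotient_eq_iff[OF eq] unfolding flat_torus_def by blast
  have ne: "P \<noteq> {}" if "P \<in> flat_torus n a" for P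
    using that in_quotient_imp_non_empty[OF eq] unfolding flat_torus_def by blast
  show "0 \<le> flat_dist n P Q" for P Q
    using flat_dist_greatest[of P Q 0 n] by (cases "P = {} \<or> Q = {}") (auto simp: flat_dist_def)
  have sym: "L2_set (\<lambda>i. x i - y i) {..<n} = L2_set (\<lambda>i. y i - x i) {..<n}" for x y :: "nat \<Rightarrow> real"
    by (simp add: L2_set_def power2_commute)
  show "flat_dist n P Q = flat_dist n Q P" for P Q
  proof -
    have "{L2_set (\<lambda>i. x i - y i) {..<n} | x y. x \<in> P \<and> y \<in> Q}
        = {L2_set (\<lambda>i. x i - y i) {..<n} | x y. x \<in> Q \<and> y \<in> P}"
      using sym by blast
    then show ?thesis unfolding flat_dist_def by auto
  qed
  show "flat_dist n P Q = 0 \<longleftrightarrow> P = Q" if P: "P \<in> flat_torus n a" and Q: "Q \<in> flat_torus n a" for P Q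
  proof
    assume "P = Q"
    moreover obtain x where "x \<in> P" using ne[OF P] by blast
    ultimately have "flat_dist n P Q \<le> 0"
      using flat_dist_le[of x P x Q n] by (simp add: L2_set_def)
    then show "flat_dist n P Q = 0" using \<open>\<And>P Q. 0 \<le> flat_dist n P Q\<close>[of P Q] by simp
  next
    assume d0: "flat_dist n P Q = 0"
    obtain x y where x: "x \<in> P" and y: "y \<in> Q" using ne P Q by blast
    have "x i - y i = a i * of_int (round ((x i - y i) / a i))" if i: "i < n" for i
    proof -
      define t where "t = (x i - y i) / a i"
      have "\<bar>of_int (round t) - t\<bar> \<le> e" if "e > 0" for e :: real
      proof -
        have "e * a i > 0" using that a[OF i] by simp
        then obtain x' y' where x': "x' \<in> P" and y': "y' \<in> Q"
          and less: "L2_set (\<lambda>i. x' i - y' i) {..<n} < e * a i"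
          using flat_dist_approx[OF ne[OF P] ne[OF Q]] d0 by (metis add_0)
        obtain m m' :: int where m: "x i - x' i = a i * of_int m" "y i - y' i = a i * of_int m'"
          using lattice_relD[OF rel[OF P x x'] i] lattice_relD[OF rel[OF Q y y'] i] by blast
        have "\<bar>x' i - y' i\<bar> = L2_set (\<lambda>j. x' j - y' j) {i}"
          by (simp add: L2_set_def)
        also have "\<dots> \<le> L2_set (\<lambda>i. x' i - y' i) {..<n}"
          unfolding L2_set_def using i by (intro real_sqrt_le_mono sum_mono2) auto
        finally have *: "\<bar>x' i - y' i\<bar> < e * a i" using less by linarith
        have "x' i - y' i = a i * (t - of_int (m - m'))"
          using m a[OF i] unfolding t_def by (simp add: field_simps)
        with * have "\<bar>t - of_int (m - m')\<bar> < e"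
          using a[OF i] by (simp add: abs_mult mult.commute)
        then show ?thesis
          using round_diff_minimal[of t "m - m'"] by linarith
      qed
      then have "\<bar>of_int (round t) - t\<bar> \<le> 0" by (rule dense_ge)
      then show ?thesis unfolding t_def using a[OF i] by (simp add: field_simps)
    qed
    moreover have "x \<in> topspace (Euclidean_space n)" "y \<in> topspace (Euclidean_space n)"
      using rel[OF P x x] rel[OF Q y y] by (auto simp: lattice_rel_def)
    ultimately have "(x, y) \<in> lattice_rel n a"
      unfolding lattice_rel_def by blast
    then show "P = Q"
      using quotient_eqI[OF eq] P Q x y unfolding flat_torus_def by blast
  qed
  show "flat_dist n P R \<le> flat_dist n P Q + flat_dist n Q R"
    if P: "P \<in> flat_torus n a" and Q: "Q \<in> flat_torus n a" and R: "R \<in> flat_torus n a" for P Q R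
  proof (rule field_le_epsilon)
    fix e :: real assume "e > 0"
    then have e: "e / 2 > 0" by simp
    obtain p q where pq: "p \<in> P" "q \<in> Q" "L2_set (\<lambda>i. p i - q i) {..<n} < flat_dist n P Q + e / 2"
      using flat_dist_approx[OF ne[OF P] ne[OF Q] e] .
    obtain q' r where qr: "q' \<in> Q" "r \<in> R" "L2_set (\<lambda>i. q' i - r i) {..<n} < flat_dist n Q R + e / 2"
      using flat_dist_approx[OF ne[OF Q] ne[OF R] e] .
    define r' where "r' = (\<lambda>i. r i + (q i - q' i))"
    have "(q, q') \<in> lattice_rel n a" "(r, r) \<in> lattice_rel n a"
      using rel Q R pq qr by blast+
    then have "(r', r) \<in> lattice_rel n a"
      by (auto simp: lattice_rel_def r'_def topspace_Euclidean_space)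
    then have "r' \<in> R"
      using R \<open>r \<in> R\<close> in_quotient_imp_closed[OF eq] eq unfolding flat_torus_def
      by (meson equivE symE)
    then have "flat_dist n P R \<le> L2_set (\<lambda>i. p i - r' i) {..<n}"
      using pq flat_dist_le by blast
    also have "\<dots> = L2_set (\<lambda>i. (p i - q i) + (q' i - r i)) {..<n}"
      by (simp add: r'_def algebra_simps)
    also have "\<dots> \<le> L2_set (\<lambda>i. p i - q i) {..<n} + L2_set (\<lambda>i. q' i - r i) {..<n}"
      by (rule L2_set_triangle_ineq)
    finally show "flat_dist n P R \<le> flat_dist n P Q + flat_dist n Q R + e"
      using pq qr by linarith
  qed
qed

text \<open>
  The \<open>m\<close>-dimensional Hausdorff (outer) measure of a set \<open>S\<close> in a metric space \<open>(M, d)\<close>, normalised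
  by the volume of the \<open>m\<close>-dimensional unit ball so that it agrees with \<open>m\<close>-dimensional Riemannian
  volume. The empty set is treated separately because \<open>0 ^ 0 = 1\<close>: for \<open>m = 0\<close> a nonempty set
  contributes \<open>1\<close> whatever its diameter, the empty set \<open>0\<close>, and one gets the counting measure.
\<close>

definition ediameter :: "('a \<Rightarrow> 'a \<Rightarrow> real) \<Rightarrow> 'a set \<Rightarrow> ennreal" where
  "ediameter d U = (SUP x\<in>U. SUP y\<in>U. ennreal (d x y))"

definition hausdorff_weight :: "('a \<Rightarrow> 'a \<Rightarrow> real) \<Rightarrow> nat \<Rightarrow> 'a set \<Rightarrow> ennreal" where
  "hausdorff_weight d m U =
     (if U = {} then 0 else ennreal (unit_ball_vol (real m)) * (ediameter d U / 2) ^ m)"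

definition hausdorff_measure ::
    "'a set \<Rightarrow> ('a \<Rightarrow> 'a \<Rightarrow> real) \<Rightarrow> nat \<Rightarrow> 'a set \<Rightarrow> ennreal" where
  "hausdorff_measure M d m S =
     (SUP \<delta>\<in>{0::real<..}.
        INF U\<in>{U :: nat \<Rightarrow> 'a set. (\<forall>j. U j \<subseteq> M \<and> ediameter d (U j) \<le> ennreal \<delta>) \<and> S \<subseteq> (\<Union>j. U j)}.
          \<Sum>j. hausdorff_weight d m (U j))"

end

theory Submission
  imports Defs
begin

text \<open>
  \<^bold>\<open>The map.\<close> Write \<open>m = n - k\<close> and forget the \<open>m\<close> shortest circles: what remains is a torus of dimension
  \<open>k\<close>, whose points are given by unit complex numbers \<open>u\<^sub>0, \<dots>, u\<^sub>k\<^sub>-\<^sub>1\<close>. This \<open>k\<close>-torus maps to \<open>\<real>\<^sup>k\<close> with at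
  most two points in each fibre: flatten the circle of \<open>u\<^sub>0\<close> to an interval by taking its real part, and
  embed the product of that interval and the remaining \<open>(k - 1)\<close>-torus in \<open>\<real>\<^sup>k\<close> as a solid of
  revolution (for \<open>k = 2\<close> an annulus), revolving once for every further circle. A revolution replaces a coordinate
  \<open>r > 0\<close> by the two coordinates of \<open>r u\<^sub>j\<close>, from which \<open>r\<close> and \<open>u\<^sub>j\<close> can be read off; the exponential
  makes one of these two positive again, so that it can serve as the radius of the next revolution
  (\<open>radius\<close>, \<open>radius_inj\<close>, \<open>fold_coord_fibre\<close>). A fibre of the composition with the projection is
  thus contained in two translates of the subtorus of the first \<open>m\<close> circles (\<open>fold_torus_fibre\<close>).

  \<^bold>\<open>The volume.\<close> A translate of that subtorus is the image, under a map that does not increase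
  distances, of a box in \<open>\<real>\<^sup>m\<close> with sides \<open>a 0, \<dots>, a (m - 1)\<close>, so it has to be shown that the Hausdorff
  measure of a box is at most the product of its sides (\<open>hausdorff_content_box_le\<close>). With
  the normalisation by the volume of the unit ball this requires coverings that consist
  of disjoint balls, up to a remainder of small cost. Instead of choosing such a covering, a
  self-similarity argument is used. Let \<open>\<kappa>\<close> be the infimal cost of covering the box \<open>P\<close> by sets
  of diameter at most \<open>D\<close>, for one \<open>D\<close> at least the diameter of \<open>P\<close>. Cut \<open>P\<close> into \<open>N\<^sup>m\<close> copies of itself,
  scaled by \<open>1 / N\<close>; each of them costs at most \<open>\<kappa> / N\<^sup>m\<close>. Cover an inscribed ball \<open>B\<close> of \<open>P\<close> by the
  single set \<open>B\<close>, which costs exactly its volume, and the rest of \<open>P\<close> by the small copies that are not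
  contained in \<open>B\<close>. For large \<open>N\<close> the proportion of these copies tends to \<open>1 - vol B / vol P\<close>, so that
  \<open>\<kappa> \<le> vol B + (1 - vol B / vol P) \<kappa>\<close>, that is, \<open>\<kappa> \<le> vol P\<close>. Cutting \<open>P\<close> once more shows that smaller
  bounds on the diameters do not increase the cost (\<open>hausdorff_content_box_le_scale\<close>).
\<close>

section \<open>Hausdorff content at a fixed scale\<close>

text \<open>
  The infimum at a fixed scale \<open>\<delta>\<close> that occurs in \<^const>\<open>hausdorff_measure\<close>. All estimates are made
  for one \<open>\<delta>\<close>, because it is here that scaling maps, which change \<open>\<delta>\<close>, can be tracked.
\<close>
definition hausdorff_content ::
    "'a set \<Rightarrow> ('a \<Rightarrow> 'a \<Rightarrow> real) \<Rightarrow> nat \<Rightarrow> real \<Rightarrow> 'a set \<Rightarrow> ennreal" where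
  "hausdorff_content M d m \<delta> S =
     (INF U\<in>{U :: nat \<Rightarrow> 'a set. (\<forall>j. U j \<subseteq> M \<and> ediameter d (U j) \<le> ennreal \<delta>) \<and> S \<subseteq> (\<Union>j. U j)}.
        \<Sum>j. hausdorff_weight d m (U j))"

lemma hausdorff_measure_eq_SUP_content:
  "hausdorff_measure M d m S = (SUP \<delta>\<in>{0<..}. hausdorff_content M d m \<delta> S)"
  by (simp add: hausdorff_measure_def hausdorff_content_def)

lemma hausdorff_content_le:
  assumes "\<And>j. U j \<subseteq> M" "\<And>j. ediameter d (U j) \<le> ennreal \<delta>" "S \<subseteq> (\<Union>j. U j)"
  shows "hausdorff_content M d m \<delta> S \<le> (\<Sum>j. hausdorff_weight d m (U j))"
  unfolding hausdorff_content_def using assms by (intro INF_lower) blast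

lemma hausdorff_content_greatest:
  assumes "\<And>U. (\<And>j. U j \<subseteq> M) \<Longrightarrow> (\<And>j. ediameter d (U j) \<le> ennreal \<delta>) \<Longrightarrow> S \<subseteq> (\<Union>j. U j) \<Longrightarrow>
             c \<le> (\<Sum>j. hausdorff_weight d m (U j))"
  shows "c \<le> hausdorff_content M d m \<delta> S"
  unfolding hausdorff_content_def using assms by (intro INF_greatest) blast

lemma hausdorff_content_approx:
  assumes "hausdorff_content M d m \<delta> S < c"
  obtains U where "\<And>j. U j \<subseteq> M" "\<And>j. ediameter d (U j) \<le> ennreal \<delta>" "S \<subseteq> (\<Union>j. U j)"
    "(\<Sum>j. hausdorff_weight d m (U j)) < c"
  using assms unfolding hausdorff_content_def INF_less_iff by blast

lemma hausdorff_content_antimono: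
  assumes "S \<subseteq> T" "\<delta> \<le> \<epsilon>"
  shows "hausdorff_content M d m \<epsilon> S \<le> hausdorff_content M d m \<delta> T"
proof (rule hausdorff_content_greatest)
  fix U :: "nat \<Rightarrow> _"
  assume "\<And>j. U j \<subseteq> M" "\<And>j. ediameter d (U j) \<le> ennreal \<delta>" "T \<subseteq> (\<Union>j. U j)"
  moreover have "ennreal \<delta> \<le> ennreal \<epsilon>" using assms(2) by (rule ennreal_leI)
  ultimately show "hausdorff_content M d m \<epsilon> S \<le> (\<Sum>j. hausdorff_weight d m (U j))"
    using assms(1) by (intro hausdorff_content_le) (blast intro: order_trans)+
qed

lemma ediameter_empty [simp]: "ediameter d {} = 0"
  by (simp add: ediameter_def bot_ennreal)

lemma hausdorff_weight_empty [simp]: "hausdorff_weight d m {} = 0"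
  by (simp add: hausdorff_weight_def)

lemma hausdorff_content_le_weight:
  assumes "U \<subseteq> M" "ediameter d U \<le> ennreal \<delta>"
  shows "hausdorff_content M d m \<delta> U \<le> hausdorff_weight d m U"
proof -
  define V where "V j = (if j = 0 then U else {})" for j :: nat
  have "hausdorff_content M d m \<delta> U \<le> (\<Sum>j. hausdorff_weight d m (V j))"
    using assms by (intro hausdorff_content_le) (auto simp: V_def)
  also have "\<dots> = (\<Sum>j\<in>{0}. hausdorff_weight d m (V j))"
    by (intro suminf_finite) (auto simp: V_def)
  finally show ?thesis by (simp add: V_def)
qed

text \<open>
  Covering \<open>U\<close> by itself. For a Euclidean ball of radius \<open>r\<close> the bound is its volume, which is what makes balls
  the efficient sets to cover with.
\<close>
lemma hausdorff_content_le_ball_volume: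
  assumes "0 \<le> r" "2 * r \<le> \<delta>" "U \<subseteq> M" and dist: "\<And>x y. x \<in> U \<Longrightarrow> y \<in> U \<Longrightarrow> d x y \<le> 2 * r"
  shows "hausdorff_content M d m \<delta> U \<le> ennreal (unit_ball_vol m * r ^ m)"
proof -
  have diam: "ediameter d U \<le> ennreal (2 * r)"
    unfolding ediameter_def using dist by (intro SUP_least ennreal_leI)
  then have "ediameter d U \<le> ennreal \<delta>"
    using assms(2) by (meson ennreal_leI order_trans)
  then have "hausdorff_content M d m \<delta> U \<le> hausdorff_weight d m U"
    using assms(3) by (rule hausdorff_content_le_weight[rotated])
  also have "\<dots> \<le> ennreal (unit_ball_vol m) * (ennreal (2 * r) / 2) ^ m"
    unfolding hausdorff_weight_def
    using diam by (auto intro!: mult_left_mono power_mono divide_right_mono_ennreal)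
  also have "ennreal (2 * r) / 2 = ennreal r"
    using \<open>0 \<le> r\<close> divide_ennreal[of "2 * r" 2] by simp
  also have "ennreal (unit_ball_vol m) * ennreal r ^ m = ennreal (unit_ball_vol m * r ^ m)"
    using \<open>0 \<le> r\<close> by (simp add: ennreal_power ennreal_mult')
  finally show ?thesis .
qed

lemma hausdorff_content_empty [simp]: "hausdorff_content M d m \<delta> {} = 0"
  using hausdorff_content_le_weight[of "{}" M d \<delta> m] by simp

text \<open>
  Two nearly optimal coverings are merged into one sequence by the pairing bijection on \<^typ>\<open>nat\<close>,
  as the first two rows of an otherwise empty double sequence.
\<close>
lemma hausdorff_content_Un_le:
  "hausdorff_content M d m \<delta> (S \<union> T) \<le> hausdorff_content M d m \<delta> S + hausdorff_content M d m \<delta> T"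
proof (rule ennreal_le_epsilon)
  fix e :: real
  let ?c = "hausdorff_content M d m \<delta>"
  assume fin: "?c S + ?c T < top" and "0 < e"
  have "?c S < ?c S + ennreal (e / 2)" "?c T < ?c T + ennreal (e / 2)"
    using fin \<open>0 < e\<close> by (auto simp: ennreal_zero_less_divide less_top)
  then obtain V W where
    V: "\<And>j. V j \<subseteq> M" "\<And>j. ediameter d (V j) \<le> ennreal \<delta>" "S \<subseteq> (\<Union>j. V j)"
      "(\<Sum>j. hausdorff_weight d m (V j)) < ?c S + ennreal (e / 2)" and
    W: "\<And>j. W j \<subseteq> M" "\<And>j. ediameter d (W j) \<le> ennreal \<delta>" "T \<subseteq> (\<Union>j. W j)"
      "(\<Sum>j. hausdorff_weight d m (W j)) < ?c T + ennreal (e / 2)"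
    by (metis hausdorff_content_approx)
  define X where "X = (\<lambda>(i::nat, j). if i = 0 then V j else if i = 1 then W j else {})"
  have "S \<union> T \<subseteq> (\<Union>j. X (prod_decode j))"
  proof
    fix x assume "x \<in> S \<union> T"
    then obtain j where "x \<in> X (0, j) \<or> x \<in> X (1, j)"
      using V(3) W(3) by (auto simp: X_def)
    then show "x \<in> (\<Union>j. X (prod_decode j))"
      by (metis UN_I UNIV_I prod_encode_inverse)
  qed
  then have "?c (S \<union> T) \<le> (\<Sum>j. hausdorff_weight d m (X (prod_decode j)))"
    using V(1,2) W(1,2) by (intro hausdorff_content_le) (auto simp: X_def split: prod.split)
  also have "\<dots> = (\<Sum>i. \<Sum>j. hausdorff_weight d m (X (i, j)))"
    by (rule suminf_ennreal_2dimen) simp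
  also have "\<dots> = (\<Sum>i\<in>{0, 1}. \<Sum>j. hausdorff_weight d m (X (i, j)))"
    by (intro suminf_finite) (auto simp: X_def)
  also have "\<dots> = (\<Sum>j. hausdorff_weight d m (V j)) + (\<Sum>j. hausdorff_weight d m (W j))"
    by (simp add: X_def)
  also have "\<dots> \<le> (?c S + ennreal (e / 2)) + (?c T + ennreal (e / 2))"
    using V(4) W(4) by (intro add_mono) auto
  also have "\<dots> = ?c S + ?c T + (ennreal (e / 2) + ennreal (e / 2))"
    by (simp add: ac_simps)
  also have "ennreal (e / 2) + ennreal (e / 2) = ennreal e"
    using \<open>0 < e\<close> by (subst ennreal_plus[symmetric]) auto
  finally show "?c (S \<union> T) \<le> ?c S + ?c T + ennreal e" .
qed

lemma hausdorff_content_UN_le: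
  assumes "finite I"
  shows "hausdorff_content M d m \<delta> (\<Union>i\<in>I. S i) \<le> (\<Sum>i\<in>I. hausdorff_content M d m \<delta> (S i))"
  using assms
proof induction
  case (insert i I)
  have "hausdorff_content M d m \<delta> (\<Union>i\<in>insert i I. S i)
      \<le> hausdorff_content M d m \<delta> (S i) + hausdorff_content M d m \<delta> (\<Union>i\<in>I. S i)"
    using hausdorff_content_Un_le[of M d m \<delta> "S i" "\<Union>i\<in>I. S i"] by simp
  also have "\<dots> \<le> hausdorff_content M d m \<delta> (S i) + (\<Sum>i\<in>I. hausdorff_content M d m \<delta> (S i))"
    using insert.IH by (intro add_left_mono)
  finally show ?case using insert.hyps by simp
qed simp

text \<open>
  The factor \<open>s\<close> enters the scale as well as the cost. This covers scaled copies of a box, with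
  \<open>s = 1 / N\<close>, as well as the passage from a box to the torus, with \<open>s = 1\<close>.
\<close>
lemma hausdorff_content_image_le:
  assumes "0 < s" "\<phi> ` M \<subseteq> M'"
    and lip: "\<And>x y. x \<in> M \<Longrightarrow> y \<in> M \<Longrightarrow> d' (\<phi> x) (\<phi> y) \<le> s * d x y"
  shows "hausdorff_content M' d' m (s * \<delta>) (\<phi> ` S) \<le> ennreal (s ^ m) * hausdorff_content M d m \<delta> S"
proof -
  have diam: "ediameter d' (\<phi> ` U) \<le> ennreal s * ediameter d U" if "U \<subseteq> M" for U
    unfolding ediameter_def
  proof (intro SUP_least)
    fix x' y' assume "x' \<in> \<phi> ` U" "y' \<in> \<phi> ` U"
    then obtain x y where xy: "x \<in> U" "y \<in> U" "x' = \<phi> x" "y' = \<phi> y" by blast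
    then have "ennreal (d' x' y') \<le> ennreal (s * d x y)"
      using lip that by (intro ennreal_leI) blast
    also have "\<dots> = ennreal s * ennreal (d x y)"
      using \<open>0 < s\<close> by (simp add: ennreal_mult')
    also have "ennreal (d x y) \<le> (SUP x\<in>U. SUP y\<in>U. ennreal (d x y))"
      using xy by (meson SUP_upper2 order_refl)
    finally show "ennreal (d' x' y') \<le> ennreal s * (SUP x\<in>U. SUP y\<in>U. ennreal (d x y))"
      by (simp add: mult_left_mono)
  qed
  have weight: "hausdorff_weight d' m (\<phi> ` U) \<le> ennreal (s ^ m) * hausdorff_weight d m U"
    if "U \<subseteq> M" for U
  proof (cases "U = {}")
    case False
    have "(ediameter d' (\<phi> ` U) / 2) ^ m \<le> (ennreal s * ediameter d U / 2) ^ m"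
      using diam[OF that] by (intro power_mono divide_right_mono_ennreal) auto
    also have "\<dots> = ennreal (s ^ m) * (ediameter d U / 2) ^ m"
      using \<open>0 < s\<close>
      by (simp add: ennreal_times_divide[symmetric] power_mult_distrib ennreal_power)
    finally show ?thesis
      using False by (simp add: hausdorff_weight_def mult_left_mono mult.left_commute)
  qed simp
  have s1: "ennreal (1 / s ^ m) * ennreal (s ^ m) = 1"
    using \<open>0 < s\<close> by (simp add: ennreal_mult'[symmetric])
  have "ennreal (1 / s ^ m) * hausdorff_content M' d' m (s * \<delta>) (\<phi> ` S) \<le> hausdorff_content M d m \<delta> S"
  proof (rule hausdorff_content_greatest)
    fix U :: "nat \<Rightarrow> _"
    assume U: "\<And>j. U j \<subseteq> M" "\<And>j. ediameter d (U j) \<le> ennreal \<delta>" "S \<subseteq> (\<Union>j. U j)"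
    have diamU: "ediameter d' (\<phi> ` U j) \<le> ennreal (s * \<delta>)" for j
      using diam[OF U(1)] U(2)[of j] \<open>0 < s\<close>
      by (metis ennreal_mult' less_imp_le mult_left_mono order_trans zero_le)
    have "hausdorff_content M' d' m (s * \<delta>) (\<phi> ` S) \<le> (\<Sum>j. hausdorff_weight d' m (\<phi> ` U j))"
    proof (rule hausdorff_content_le)
      show "\<phi> ` U j \<subseteq> M'" for j using U(1)[of j] assms(2) by blast
      show "ediameter d' (\<phi> ` U j) \<le> ennreal (s * \<delta>)" for j by (rule diamU)
      show "\<phi> ` S \<subseteq> (\<Union>j. \<phi> ` U j)" using U(3) by blast
    qed
    also have "\<dots> \<le> (\<Sum>j. ennreal (s ^ m) * hausdorff_weight d m (U j))"
      using weight[OF U(1)] by (intro suminf_le) auto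
    also have "\<dots> = ennreal (s ^ m) * (\<Sum>j. hausdorff_weight d m (U j))"
      by simp
    finally have "ennreal (1 / s ^ m) * hausdorff_content M' d' m (s * \<delta>) (\<phi> ` S)
        \<le> ennreal (1 / s ^ m) * (ennreal (s ^ m) * (\<Sum>j. hausdorff_weight d m (U j)))"
      by (rule mult_left_mono) simp
    then show "ennreal (1 / s ^ m) * hausdorff_content M' d' m (s * \<delta>) (\<phi> ` S)
        \<le> (\<Sum>j. hausdorff_weight d m (U j))"
      using s1 by (simp add: mult.assoc[symmetric])
  qed
  then have "ennreal (s ^ m) * (ennreal (1 / s ^ m) * hausdorff_content M' d' m (s * \<delta>) (\<phi> ` S))
      \<le> ennreal (s ^ m) * hausdorff_content M d m \<delta> S"
    by (rule mult_left_mono) simp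
  then show ?thesis
    using s1 by (simp add: mult.assoc[symmetric] mult.commute[of "ennreal (s ^ m)"])
qed

section \<open>The Hausdorff content of a box\<close>

text \<open>
  The points of \<open>\<real>\<^sup>m\<close> are represented by arbitrary functions on \<^typ>\<open>nat\<close>, of which only the values below \<open>m\<close>
  count. Hence this is a pseudometric, which suffices for Hausdorff content.
\<close>
definition euclid_dist :: "nat \<Rightarrow> (nat \<Rightarrow> real) \<Rightarrow> (nat \<Rightarrow> real) \<Rightarrow> real" where
  "euclid_dist m x y = L2_set (\<lambda>i. x i - y i) {..<m}"

lemma euclid_dist_commute: "euclid_dist m x y = euclid_dist m y x"
  by (simp add: euclid_dist_def L2_set_def power2_commute)

lemma euclid_dist_triangle: "euclid_dist m x z \<le> euclid_dist m x y + euclid_dist m y z"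
  using L2_set_triangle_ineq[of "\<lambda>i. x i - y i" "\<lambda>i. y i - z i" "{..<m}"]
  by (simp add: euclid_dist_def)

lemma abs_coord_diff_le_euclid_dist: "i < m \<Longrightarrow> \<bar>x i - y i\<bar> \<le> euclid_dist m x y"
  unfolding euclid_dist_def
  using member_le_L2_set[of "{..<m}" i "\<lambda>i. \<bar>x i - y i\<bar>"] by (simp add: L2_set_def)

lemma euclid_dist_le_sum: "euclid_dist m x y \<le> (\<Sum>i<m. \<bar>x i - y i\<bar>)"
  unfolding euclid_dist_def by (rule L2_set_le_sum_abs)

lemma euclid_dist_scale_shift:
  assumes "0 \<le> s"
  shows "euclid_dist m (\<lambda>i. s * x i + t i) (\<lambda>i. s * y i + t i) = s * euclid_dist m x y"
  unfolding euclid_dist_def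
  using L2_set_right_distrib[OF assms, of "\<lambda>i. x i - y i" "{..<m}"] by (simp add: algebra_simps)

definition centred_box :: "nat \<Rightarrow> (nat \<Rightarrow> real) \<Rightarrow> (nat \<Rightarrow> real) set" where
  "centred_box m a = {x. \<forall>i<m. - (a i / 2) \<le> x i \<and> x i < a i / 2}"

text \<open>
  The similarity of ratio \<open>1 / N\<close> that takes a centred box with sides \<open>a\<close> to the cell with index \<open>\<iota>\<close>
  in its division into \<open>N\<^sup>m\<close> cells; the translation part is the centre of that cell.
\<close>
definition cell_map :: "(nat \<Rightarrow> real) \<Rightarrow> nat \<Rightarrow> (nat \<Rightarrow> nat) \<Rightarrow> (nat \<Rightarrow> real) \<Rightarrow> (nat \<Rightarrow> real)" where
  "cell_map a N \<iota> x = (\<lambda>i. 1 / real N * x i + (a i * (real (\<iota> i) + 1 / 2) / real N - a i / 2))"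

abbreviation cell_indices :: "nat \<Rightarrow> nat \<Rightarrow> (nat \<Rightarrow> nat) set" where
  "cell_indices m N \<equiv> {..<m} \<rightarrow>\<^sub>E {..<N}"

lemma centred_box_subset_cells:
  assumes a: "\<And>i. i < m \<Longrightarrow> 0 < a i" and N: "0 < N"
  shows "centred_box m a \<subseteq> (\<Union>\<iota>\<in>cell_indices m N. cell_map a N \<iota> ` centred_box m a)"
proof
  fix x assume x: "x \<in> centred_box m a"
  define t where "t i = real N * (x i / a i + 1 / 2)" for i
  define \<iota> where "\<iota> = restrict (\<lambda>i. nat \<lfloor>t i\<rfloor>) {..<m}"
  define z where "z i = real N * (x i - (a i * (real (\<iota> i) + 1 / 2) / real N - a i / 2))" for i
  have t: "0 \<le> t i \<and> t i < N" if "i < m" for i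
  proof -
    have "0 \<le> x i / a i + 1 / 2 \<and> x i / a i + 1 / 2 < 1"
      using x a[OF that] that by (auto simp: centred_box_def field_simps)
    then show ?thesis using N by (auto simp: t_def)
  qed
  have \<iota>: "real (\<iota> i) = of_int \<lfloor>t i\<rfloor>" if "i < m" for i
    using t[OF that] that by (simp add: \<iota>_def)
  have "\<iota> \<in> cell_indices m N"
  proof (rule PiE_I)
    fix i assume "i \<in> {..<m}"
    then show "\<iota> i \<in> {..<N}" using t[of i] by (simp add: \<iota>_def) linarith
  qed (simp add: \<iota>_def)
  moreover have "z \<in> centred_box m a"
    unfolding centred_box_def
  proof safe
    fix i assume i: "i < m"
    have eq: "z i = a i * (t i - real (\<iota> i)) - a i / 2"
      using a[OF i] N by (simp add: z_def t_def field_simps)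
    have "0 \<le> t i - real (\<iota> i)" "t i - real (\<iota> i) < 1"
      using \<iota>[OF i] by linarith+
    then have "0 \<le> a i * (t i - real (\<iota> i))" "a i * (t i - real (\<iota> i)) < a i"
      using a[OF i] by auto
    then show "- (a i / 2) \<le> z i" "z i < a i / 2"
      unfolding eq by linarith+
  qed
  moreover have "cell_map a N \<iota> z = x"
    using N by (auto simp: cell_map_def z_def)
  ultimately show "x \<in> (\<Union>\<iota>\<in>cell_indices m N. cell_map a N \<iota> ` centred_box m a)"
    by blast
qed

lemma card_cell_indices: "card (cell_indices m N) = N ^ m"
  by (simp add: card_PiE)

lemma finite_cell_indices: "finite (cell_indices m N)"
  by (intro finite_PiE) auto

lemma hausdorff_content_cell_le:
  assumes "0 < N"
  shows "hausdorff_content UNIV (euclid_dist m) m (D / N) (cell_map a N \<iota> ` S)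
           \<le> ennreal ((1 / N) ^ m) * hausdorff_content UNIV (euclid_dist m) m D S"
proof -
  have "euclid_dist m (cell_map a N \<iota> x) (cell_map a N \<iota> y) = 1 / real N * euclid_dist m x y" for x y
    unfolding cell_map_def by (rule euclid_dist_scale_shift) simp
  then show ?thesis
    using hausdorff_content_image_le[of "1 / real N" "cell_map a N \<iota>" UNIV UNIV
        "euclid_dist m" "euclid_dist m" m D S] assms
    by simp
qed

lemma hausdorff_content_cells_le:
  assumes "0 < N" "I \<subseteq> cell_indices m N"
  shows "hausdorff_content UNIV (euclid_dist m) m (D / N) (\<Union>\<iota>\<in>I. cell_map a N \<iota> ` S)
           \<le> ennreal (real (card I) / real N ^ m) * hausdorff_content UNIV (euclid_dist m) m D S"
proof -
  have fin: "finite I" using assms finite_cell_indices finite_subset by blast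
  have "hausdorff_content UNIV (euclid_dist m) m (D / N) (\<Union>\<iota>\<in>I. cell_map a N \<iota> ` S)
      \<le> (\<Sum>\<iota>\<in>I. hausdorff_content UNIV (euclid_dist m) m (D / N) (cell_map a N \<iota> ` S))"
    by (rule hausdorff_content_UN_le[OF fin])
  also have "\<dots> \<le> (\<Sum>\<iota>\<in>I. ennreal ((1 / N) ^ m) * hausdorff_content UNIV (euclid_dist m) m D S)"
    by (intro sum_mono hausdorff_content_cell_le assms)
  also have "\<dots> = ennreal (real (card I)) * ennreal ((1 / N) ^ m) * hausdorff_content UNIV (euclid_dist m) m D S"
    by (simp add: mult.assoc ennreal_of_nat_eq_real_of_nat)
  also have "ennreal (real (card I)) * ennreal ((1 / N) ^ m) = ennreal (real (card I) / real N ^ m)"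
    by (simp add: ennreal_mult'[symmetric] power_one_over)
  finally show ?thesis .
qed

text \<open>
  A covering of the box at scale \<open>D\<close> can be repeated in each of the \<open>N\<^sup>m\<close> cells, shrunk by \<open>1 / N\<close>: the
  total cost is the same, whereas the scale becomes \<open>D / N\<close>, as small as desired.
\<close>
lemma hausdorff_content_box_le_scale:
  assumes a: "\<And>i. i < m \<Longrightarrow> 0 < a i" and "0 < \<delta>" and "0 < D"
  shows "hausdorff_content UNIV (euclid_dist m) m \<delta> (centred_box m a)
           \<le> hausdorff_content UNIV (euclid_dist m) m D (centred_box m a)"
proof -
  let ?c = "hausdorff_content UNIV (euclid_dist m) m"
  define N where "N = nat \<lceil>D / \<delta>\<rceil>"
  have N: "0 < N" "D / \<delta> \<le> N" using assms unfolding N_def by (auto simp: le_of_int_ceiling)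
  then have "D / N \<le> \<delta>" using assms by (simp add: field_simps)
  then have "?c \<delta> (centred_box m a)
      \<le> ?c (D / N) (\<Union>\<iota>\<in>cell_indices m N. cell_map a N \<iota> ` centred_box m a)"
    using centred_box_subset_cells[OF a N(1)] by (intro hausdorff_content_antimono) auto
  also have "\<dots> \<le> ennreal (real (card (cell_indices m N)) / real N ^ m) * ?c D (centred_box m a)"
    using N by (intro hausdorff_content_cells_le) auto
  also have "\<dots> = ?c D (centred_box m a)"
    using N by (simp add: card_cell_indices)
  finally show ?thesis .
qed

text \<open>
  The only place where Lebesgue measure enters: cells that cover a ball have at least its volume in
  total. Since the dimension \<open>m\<close> is a variable, the measure is the product measure on functions on
  \<open>{..<m}\<close>, for which \<open>emeasure_cball_aux\<close> gives the volume of a ball.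
\<close>
lemma ball_volume_le_cells:
  assumes a: "\<And>i. i < m \<Longrightarrow> 0 < a i" and "0 < N" "0 < \<rho>" and I: "I \<subseteq> cell_indices m N"
    and cover: "{x. euclid_dist m x (\<lambda>_. 0) \<le> \<rho>} \<subseteq> (\<Union>\<iota>\<in>I. cell_map a N \<iota> ` centred_box m a)"
  shows "unit_ball_vol m * \<rho> ^ m \<le> real (card I) / real N ^ m * (\<Prod>i<m. a i)"
proof -
  interpret product_sigma_finite "\<lambda>_::nat. lborel :: real measure" by standard
  let ?M = "Pi\<^sub>M {..<m} (\<lambda>_. lborel :: real measure)"
  define J where "J \<iota> i = {a i * real (\<iota> i) / N - a i / 2 ..< a i * (real (\<iota> i) + 1) / N - a i / 2}"
    for \<iota> :: "nat \<Rightarrow> nat" and i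
  have fin: "finite I" using I finite_cell_indices finite_subset by blast
  have cell: "cell_map a N \<iota> z i \<in> J \<iota> i" if "z \<in> centred_box m a" "i < m" for \<iota> z i
  proof -
    have "- (a i / 2) \<le> z i" "z i < a i / 2" using that by (auto simp: centred_box_def)
    then show ?thesis using \<open>0 < N\<close> by (simp add: cell_map_def J_def field_simps)
  qed
  have "{x. sqrt (\<Sum>i<m. (x i)\<^sup>2) \<le> \<rho>} \<inter> space ?M \<subseteq> (\<Union>\<iota>\<in>I. Pi\<^sub>E {..<m} (J \<iota>))"
  proof
    fix x assume x: "x \<in> {x. sqrt (\<Sum>i<m. (x i)\<^sup>2) \<le> \<rho>} \<inter> space ?M"
    then have "euclid_dist m x (\<lambda>_. 0) \<le> \<rho>" by (simp add: euclid_dist_def L2_set_def)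
    then obtain \<iota> z where "\<iota> \<in> I" "z \<in> centred_box m a" "x = cell_map a N \<iota> z"
      using cover by blast
    moreover have "x \<in> extensional {..<m}" using x by (auto simp: space_PiM PiE_def)
    ultimately show "x \<in> (\<Union>\<iota>\<in>I. Pi\<^sub>E {..<m} (J \<iota>))"
      using cell by (force simp: PiE_def Pi_def)
  qed
  moreover have meas: "Pi\<^sub>E {..<m} (J \<iota>) \<in> sets ?M" for \<iota>
    by (intro sets_PiM_I_finite) (auto simp: J_def)
  ultimately have "emeasure ?M ({x. sqrt (\<Sum>i<m. (x i)\<^sup>2) \<le> \<rho>} \<inter> space ?M)
      \<le> emeasure ?M (\<Union>\<iota>\<in>I. Pi\<^sub>E {..<m} (J \<iota>))"
    using fin by (intro emeasure_mono) auto
  also have "\<dots> \<le> (\<Sum>\<iota>\<in>I. emeasure ?M (Pi\<^sub>E {..<m} (J \<iota>)))"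
    using fin meas by (intro emeasure_subadditive_finite) auto
  also have "\<dots> = (\<Sum>\<iota>\<in>I. ennreal ((\<Prod>i<m. a i) / real N ^ m))"
  proof (intro sum.cong refl)
    fix \<iota>
    have "emeasure ?M (Pi\<^sub>E {..<m} (J \<iota>)) = (\<Prod>i<m. emeasure lborel (J \<iota> i))"
      by (rule emeasure_PiM) (auto simp: J_def)
    also have "\<dots> = (\<Prod>i<m. ennreal (a i / N))"
    proof (intro prod.cong refl)
      fix i assume "i \<in> {..<m}"
      then have "0 < a i" using a by simp
      then have "a i * real (\<iota> i) / N - a i / 2 \<le> a i * (real (\<iota> i) + 1) / N - a i / 2"
        using \<open>0 < N\<close> by (simp add: field_simps)
      then show "emeasure lborel (J \<iota> i) = ennreal (a i / N)"
        unfolding J_def by (simp add: add_divide_distrib distrib_left)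
    qed
    also have "\<dots> = ennreal (\<Prod>i<m. a i / N)"
      using a by (intro prod_ennreal divide_nonneg_nonneg) (auto intro: less_imp_le)
    finally show "emeasure ?M (Pi\<^sub>E {..<m} (J \<iota>)) = ennreal ((\<Prod>i<m. a i) / real N ^ m)"
      by (simp add: prod_dividef)
  qed
  also have "\<dots> = ennreal (real (card I) * ((\<Prod>i<m. a i) / real N ^ m))"
    by (simp only: sum_constant ennreal_of_nat_eq_real_of_nat ennreal_mult'[OF of_nat_0_le_iff])
  finally have "ennreal (unit_ball_vol m * \<rho> ^ m) \<le> ennreal (real (card I) * ((\<Prod>i<m. a i) / real N ^ m))"
    using emeasure_cball_aux[of "{..<m}" \<rho>] \<open>0 < \<rho>\<close> by simp
  moreover have "0 \<le> real (card I) * ((\<Prod>i<m. a i) / real N ^ m)"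
    using a by (intro mult_nonneg_nonneg divide_nonneg_nonneg prod_nonneg) (auto intro: less_imp_le)
  ultimately show ?thesis by (simp add: ennreal_le_iff field_simps)
qed


text \<open>
  The self-similarity argument. The cells are sorted with respect to two concentric balls of
  radii \<open>\<rho> < r\<close>: when the cells are smaller than \<open>r - \<rho>\<close>, those that meet the smaller ball lie inside the
  larger one. The former property bounds their number from below, the latter allows the larger
  ball to replace them in a covering. In the end \<open>\<rho>\<close> tends to \<open>r\<close>.
\<close>
lemma hausdorff_content_box_le:
  assumes a: "\<And>i. i < m \<Longrightarrow> 0 < a i" and "0 < \<delta>"
  shows "hausdorff_content UNIV (euclid_dist m) m \<delta> (centred_box m a) \<le> ennreal (\<Prod>i<m. a i)"
proof -
  let ?c = "hausdorff_content UNIV (euclid_dist m) m"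
  let ?P = "centred_box m a"
  let ?\<omega> = "unit_ball_vol (real m)"
  define A where "A = (\<Prod>i<m. a i)"
  define r where "r = Min (insert 1 (a ` {..<m})) / 2"
  \<comment> \<open>The summand \<open>2 * r\<close> keeps \<open>D\<close> at least the diameter of the inscribed ball when \<open>m = 0\<close> as well.\<close>
  define D where "D = (\<Sum>i<m. a i) + 2 * r"
  have r: "0 < r" using a by (simp add: r_def)
  have ra: "r \<le> a i / 2" if "i < m" for i using that by (simp add: r_def)
  have "0 \<le> (\<Sum>i<m. a i)" using a by (intro sum_nonneg) (auto intro: less_imp_le)
  then have D: "0 < D" "2 * r \<le> D" using r by (auto simp: D_def)
  have A: "0 \<le> A" using a unfolding A_def by (intro prod_nonneg) (auto intro: less_imp_le)
  have distP: "euclid_dist m x y \<le> D" if "x \<in> ?P" "y \<in> ?P" for x y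
  proof -
    have "\<bar>x i - y i\<bar> \<le> a i" if "i < m" for i
    proof -
      have "- (a i / 2) \<le> x i" "x i < a i / 2" "- (a i / 2) \<le> y i" "y i < a i / 2"
        using \<open>x \<in> ?P\<close> \<open>y \<in> ?P\<close> that by (auto simp: centred_box_def)
      then show ?thesis by linarith
    qed
    then have "(\<Sum>i<m. \<bar>x i - y i\<bar>) \<le> (\<Sum>i<m. a i)" by (intro sum_mono) auto
    then show ?thesis using euclid_dist_le_sum[of m x y] r by (simp add: D_def)
  qed
  then have "?c D ?P \<le> ennreal (?\<omega> * (D / 2) ^ m)"
    using D by (intro hausdorff_content_le_ball_volume) auto
  also have "\<dots> < top" by simp
  finally have "?c D ?P < top" .
  \<comment> \<open>Finiteness is essential: the inequality below for \<open>\<kappa>\<close> is vacuous when \<open>\<kappa>\<close> is infinite.\<close>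
  then obtain \<kappa> where \<kappa>: "0 \<le> \<kappa>" "?c D ?P = ennreal \<kappa>"
    by (cases "?c D ?P") auto
  have step: "\<kappa> * \<rho> ^ m \<le> A * r ^ m" if \<rho>: "0 < \<rho>" "\<rho> < r" for \<rho>
  proof -
    define N where "N = nat \<lceil>D / (r - \<rho>)\<rceil>"
    have N: "0 < N" "D / (r - \<rho>) \<le> N"
      using D \<rho> unfolding N_def by (auto simp: le_of_int_ceiling)
    then have DN: "D / N \<le> r - \<rho>" using D \<rho> by (simp add: field_simps)
    define cell where "cell \<iota> = cell_map a N \<iota> ` ?P" for \<iota>
    define I where "I = {\<iota> \<in> cell_indices m N. cell \<iota> \<inter> {x. euclid_dist m x (\<lambda>_. 0) \<le> \<rho>} \<noteq> {}}"
    define B where "B = {x. euclid_dist m x (\<lambda>_. 0) \<le> r}"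
    have cells: "?P \<subseteq> (\<Union>\<iota>\<in>cell_indices m N. cell \<iota>)"
      unfolding cell_def using centred_box_subset_cells[OF a N(1)] by simp
    have "{x. euclid_dist m x (\<lambda>_. 0) \<le> \<rho>} \<subseteq> ?P"
    proof safe
      fix x assume x: "euclid_dist m x (\<lambda>_. 0) \<le> \<rho>"
      have "\<bar>x i\<bar> < a i / 2" if "i < m" for i
        using abs_coord_diff_le_euclid_dist[OF that, of x "\<lambda>_. 0"] x \<rho> ra[OF that] by simp
      then show "x \<in> ?P" unfolding centred_box_def by (force simp: abs_less_iff)
    qed
    then have "{x. euclid_dist m x (\<lambda>_. 0) \<le> \<rho>} \<subseteq> (\<Union>\<iota>\<in>I. cell \<iota>)"
      using cells unfolding I_def by blast
    then have vol: "?\<omega> * \<rho> ^ m \<le> real (card I) / real N ^ m * A"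
      unfolding A_def cell_def using \<rho> N I_def
      by (intro ball_volume_le_cells a) auto
    have cell_sub: "cell \<iota> \<subseteq> B" if \<iota>: "\<iota> \<in> I" for \<iota>
    proof
      fix x assume "x \<in> cell \<iota>"
      then obtain z where z: "z \<in> ?P" "x = cell_map a N \<iota> z" by (auto simp: cell_def)
      obtain w where w: "w \<in> ?P" "euclid_dist m (cell_map a N \<iota> w) (\<lambda>_. 0) \<le> \<rho>"
        using \<iota> unfolding I_def cell_def by blast
      have "euclid_dist m x (cell_map a N \<iota> w) = 1 / real N * euclid_dist m z w"
        unfolding z cell_map_def by (rule euclid_dist_scale_shift) simp
      also have "\<dots> \<le> 1 / real N * D"
        using distP[OF z(1) w(1)] by (intro mult_left_mono) auto
      finally show "x \<in> B"
        using euclid_dist_triangle[of m x "\<lambda>_. 0" "cell_map a N \<iota> w"] w(2) DN by (simp add: B_def)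
    qed
    have P_sub: "?P \<subseteq> B \<union> (\<Union>\<iota>\<in>cell_indices m N - I. cell \<iota>)"
    proof
      fix x assume "x \<in> ?P"
      then obtain \<iota> where "\<iota> \<in> cell_indices m N" "x \<in> cell \<iota>"
        by (rule UN_E[OF subsetD[OF cells]])
      then show "x \<in> B \<union> (\<Union>\<iota>\<in>cell_indices m N - I. cell \<iota>)"
        using subsetD[OF cell_sub, of \<iota> x] by (cases "\<iota> \<in> I") (simp, meson DiffI UN_I UnI2)
    qed
    have distB: "euclid_dist m x y \<le> 2 * r" if "x \<in> B" "y \<in> B" for x y
      using that euclid_dist_triangle[of m x y "\<lambda>_. 0"] euclid_dist_commute[of m y "\<lambda>_. 0"]
      by (simp add: B_def)
    then have contB: "?c D B \<le> ennreal (?\<omega> * r ^ m)"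
      using r D by (intro hausdorff_content_le_ball_volume) auto
    have "D / N \<le> D" using D N by (simp add: field_simps)
    then have "?c D (\<Union>\<iota>\<in>cell_indices m N - I. cell \<iota>) \<le> ?c (D / N) (\<Union>\<iota>\<in>cell_indices m N - I. cell \<iota>)"
      by (intro hausdorff_content_antimono) auto
    also have "\<dots> \<le> ennreal (real (card (cell_indices m N - I)) / real N ^ m) * ?c D ?P"
      unfolding cell_def using N by (intro hausdorff_content_cells_le) auto
    also have "\<dots> = ennreal (real (card (cell_indices m N - I)) / real N ^ m * \<kappa>)"
      unfolding \<kappa>(2) by (rule ennreal_mult'[symmetric]) simp
    finally have cont_rest: "?c D (\<Union>\<iota>\<in>cell_indices m N - I. cell \<iota>)
        \<le> ennreal (real (card (cell_indices m N - I)) / real N ^ m * \<kappa>)" .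
    have "ennreal \<kappa> \<le> ?c D (B \<union> (\<Union>\<iota>\<in>cell_indices m N - I. cell \<iota>))"
      unfolding \<kappa>(2)[symmetric] by (rule hausdorff_content_antimono[OF P_sub order_refl])
    also have "\<dots> \<le> ?c D B + ?c D (\<Union>\<iota>\<in>cell_indices m N - I. cell \<iota>)"
      by (rule hausdorff_content_Un_le)
    also have "\<dots> \<le> ennreal (?\<omega> * r ^ m)
        + ennreal (real (card (cell_indices m N - I)) / real N ^ m * \<kappa>)"
      using contB cont_rest by (rule add_mono)
    also have "\<dots> = ennreal (?\<omega> * r ^ m + real (card (cell_indices m N - I)) / real N ^ m * \<kappa>)"
      using r \<kappa> by (intro ennreal_plus[symmetric]) auto
    finally have "\<kappa> \<le> ?\<omega> * r ^ m + real (card (cell_indices m N - I)) / real N ^ m * \<kappa>"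
      using r \<kappa> by (subst (asm) ennreal_le_iff) auto
    also have "real (card (cell_indices m N - I)) = real N ^ m - real (card I)"
    proof -
      have "I \<subseteq> cell_indices m N" by (auto simp: I_def)
      then have "card (cell_indices m N - I) = N ^ m - card I" "card I \<le> N ^ m"
        using finite_cell_indices[of m N]
        by (auto simp: card_Diff_subset finite_subset card_mono simp flip: card_cell_indices[of m N])
      then show ?thesis by (simp add: of_nat_diff)
    qed
    also have "(real N ^ m - real (card I)) / real N ^ m = 1 - real (card I) / real N ^ m"
      using N by (simp add: diff_divide_distrib)
    \<comment> \<open>What the cells in \<open>I\<close> would have cost is at most the cost of the ball that replaces them.\<close>
    finally have q: "real (card I) / real N ^ m * \<kappa> \<le> ?\<omega> * r ^ m"
      by (simp add: algebra_simps)
    have "?\<omega> * (\<kappa> * \<rho> ^ m) = \<kappa> * (?\<omega> * \<rho> ^ m)" by simp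
    also have "\<dots> \<le> \<kappa> * (real (card I) / real N ^ m * A)"
      using vol \<kappa> by (intro mult_left_mono)
    also have "\<dots> = (real (card I) / real N ^ m * \<kappa>) * A" by simp
    also have "\<dots> \<le> (?\<omega> * r ^ m) * A" using q A by (intro mult_right_mono)
    also have "\<dots> = ?\<omega> * (A * r ^ m)" by simp
    finally show ?thesis by (simp add: mult_le_cancel_left_pos)
  qed
  have "\<forall>\<^sub>F \<rho> in at_left r. \<kappa> * \<rho> ^ m \<le> A * r ^ m"
    using r step by (auto simp: eventually_at_left intro!: exI[of _ 0])
  moreover have "((\<lambda>\<rho>. \<kappa> * \<rho> ^ m) \<longlongrightarrow> \<kappa> * r ^ m) (at_left r)"
    by (intro tendsto_intros)
  ultimately have "\<kappa> * r ^ m \<le> A * r ^ m"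
    by (intro tendsto_upperbound) auto
  then have "\<kappa> \<le> A" using r by simp
  have "?c \<delta> ?P \<le> ?c D ?P"
    using a \<open>0 < \<delta>\<close> \<open>0 < D\<close> by (rule hausdorff_content_box_le_scale)
  also have "\<dots> \<le> ennreal (\<Prod>i<m. a i)"
    using \<kappa> \<open>\<kappa> \<le> A\<close> unfolding A_def by (simp add: ennreal_leI)
  finally show ?thesis .
qed

section \<open>Subtori\<close>

lemma flat_torus_nonempty: "p \<in> flat_torus n a \<Longrightarrow> \<exists>x. x \<in> p"
  using in_quotient_imp_non_empty[OF equiv_lattice_rel] unfolding flat_torus_def by blast

lemma flat_torus_rel:
  "p \<in> flat_torus n a \<Longrightarrow> x \<in> p \<Longrightarrow> y \<in> p \<Longrightarrow> (x, y) \<in> lattice_rel n a"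
  using quotient_eq_iff[OF equiv_lattice_rel] unfolding flat_torus_def by blast

lemma flat_torus_closed:
  "p \<in> flat_torus n a \<Longrightarrow> x \<in> p \<Longrightarrow> (x, y) \<in> lattice_rel n a \<Longrightarrow> y \<in> p"
  using in_quotient_imp_closed[OF equiv_lattice_rel] unfolding flat_torus_def by blast

text \<open>
  The translates of the coordinate subtorus spanned by the first \<open>m\<close> circles; \<open>c\<close> prescribes the other
  coordinates.
\<close>
definition subtorus :: "nat \<Rightarrow> (nat \<Rightarrow> real) \<Rightarrow> nat \<Rightarrow> (nat \<Rightarrow> real) \<Rightarrow> (nat \<Rightarrow> real) set set" where
  "subtorus n a m c = {p \<in> flat_torus n a. \<exists>x\<in>p. \<forall>i. m \<le> i \<and> i < n \<longrightarrow> x i = c i}"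

text \<open>
  Completing a point of \<open>\<real>\<^sup>m\<close> by the coordinates of \<open>c\<close> and passing to its class does not increase
  distances. The centred box is a fundamental domain of the lattice, so that its image is the whole
  subtorus.
\<close>
lemma hausdorff_content_subtorus_le:
  assumes a: "\<And>i. i < n \<Longrightarrow> 0 < a i" and "m \<le> n" and "0 < \<delta>"
  shows "hausdorff_content (flat_torus n a) (flat_dist n) m \<delta> (subtorus n a m c)
           \<le> ennreal (\<Prod>i<m. a i)"
proof -
  define \<psi> where "\<psi> x = (\<lambda>i. if i < m then x i else if i < n then c i else 0)" for x :: "nat \<Rightarrow> real"
  define \<phi> where "\<phi> x = lattice_rel n a `` {\<psi> x}" for x
  have \<psi>: "\<psi> x \<in> topspace (Euclidean_space n)" for x
    using \<open>m \<le> n\<close> by (simp add: \<psi>_def topspace_Euclidean_space)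
  have in_\<phi>: "\<psi> x \<in> \<phi> x" for x
    unfolding \<phi>_def using equiv_class_self[OF equiv_lattice_rel \<psi>] .
  have \<phi>: "\<phi> x \<in> flat_torus n a" for x
    unfolding \<phi>_def flat_torus_def by (intro quotientI \<psi>)
  have lip: "flat_dist n (\<phi> x) (\<phi> y) \<le> 1 * euclid_dist m x y" for x y
  proof -
    have "flat_dist n (\<phi> x) (\<phi> y) \<le> L2_set (\<lambda>i. \<psi> x i - \<psi> y i) {..<n}"
      by (intro flat_dist_le in_\<phi>)
    also have "(\<Sum>i<n. (\<psi> x i - \<psi> y i)\<^sup>2) = (\<Sum>i<m. (x i - y i)\<^sup>2)"
      using \<open>m \<le> n\<close> by (intro sum.mono_neutral_cong_right) (auto simp: \<psi>_def)
    then have "L2_set (\<lambda>i. \<psi> x i - \<psi> y i) {..<n} = euclid_dist m x y"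
      by (simp add: L2_set_def euclid_dist_def)
    finally show ?thesis by simp
  qed
  have "subtorus n a m c \<subseteq> \<phi> ` centred_box m a"
  proof
    fix p assume "p \<in> subtorus n a m c"
    then obtain x where p: "p \<in> flat_torus n a" and x: "x \<in> p" "\<And>i. m \<le> i \<Longrightarrow> i < n \<Longrightarrow> x i = c i"
      by (auto simp: subtorus_def)
    define z where "z i = x i - a i * of_int \<lfloor>x i / a i + 1 / 2\<rfloor>" for i
    have "- (a i / 2) \<le> z i \<and> z i < a i / 2" if "i < m" for i
    proof -
      have "0 < a i" using a that \<open>m \<le> n\<close> by simp
      define t where "t = x i / a i + 1 / 2"
      have "z i = a i * (t - of_int \<lfloor>t\<rfloor>) - a i / 2"
        using \<open>0 < a i\<close> by (simp add: z_def t_def field_simps)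
      moreover have "0 \<le> a i * (t - of_int \<lfloor>t\<rfloor>)" "a i * (t - of_int \<lfloor>t\<rfloor>) < a i * 1"
        using \<open>0 < a i\<close> by (intro mult_nonneg_nonneg mult_strict_left_mono; linarith)+
      ultimately show ?thesis by linarith
    qed
    then have z: "z \<in> centred_box m a" by (simp add: centred_box_def)
    have "\<exists>l::int. x i - \<psi> z i = a i * of_int l" if "i < n" for i
      using that x(2)[of i] by (cases "i < m") (auto simp: \<psi>_def z_def intro: exI[of _ 0])
    then have "(x, \<psi> z) \<in> lattice_rel n a"
      using flat_torus_rel[OF p x(1) x(1)] \<psi>[of z] by (simp add: lattice_rel_def)
    then have "\<psi> z \<in> p" using flat_torus_closed[OF p x(1)] by blast
    then have "\<phi> z = p"
      using quotient_eqI[OF equiv_lattice_rel _ _ in_\<phi>] \<phi> p flat_torus_rel[OF p]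
      unfolding flat_torus_def by blast
    then show "p \<in> \<phi> ` centred_box m a" using z by blast
  qed
  then have "hausdorff_content (flat_torus n a) (flat_dist n) m \<delta> (subtorus n a m c)
      \<le> hausdorff_content (flat_torus n a) (flat_dist n) m (1 * \<delta>) (\<phi> ` centred_box m a)"
    by (intro hausdorff_content_antimono) auto
  also have "\<dots> \<le> ennreal (1 ^ m) * hausdorff_content UNIV (euclid_dist m) m \<delta> (centred_box m a)"
    using \<phi> lip by (intro hausdorff_content_image_le) auto
  also have "\<dots> \<le> ennreal (\<Prod>i<m. a i)"
    using a \<open>m \<le> n\<close> \<open>0 < \<delta>\<close> by (simp add: hausdorff_content_box_le)
  finally show ?thesis .
qed

lemma hausdorff_measure_two_subtori_le:
  assumes a: "\<And>i. i < n \<Longrightarrow> 0 < a i" and "m \<le> n"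
    and S: "S \<subseteq> subtorus n a m c \<union> subtorus n a m c'"
  shows "hausdorff_measure (flat_torus n a) (flat_dist n) m S \<le> ennreal (2 * (\<Prod>i<m. a i))"
  unfolding hausdorff_measure_eq_SUP_content
proof (rule SUP_least)
  fix \<delta> :: real assume "\<delta> \<in> {0<..}"
  let ?c = "hausdorff_content (flat_torus n a) (flat_dist n) m \<delta>"
  have A: "0 \<le> (\<Prod>i<m. a i)"
    using a \<open>m \<le> n\<close> by (intro prod_nonneg) (auto intro: less_imp_le)
  have "?c S \<le> ?c (subtorus n a m c \<union> subtorus n a m c')"
    using S by (rule hausdorff_content_antimono) simp
  also have "\<dots> \<le> ?c (subtorus n a m c) + ?c (subtorus n a m c')"
    by (rule hausdorff_content_Un_le)
  also have "\<dots> \<le> ennreal (\<Prod>i<m. a i) + ennreal (\<Prod>i<m. a i)"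
    using assms \<open>\<delta> \<in> {0<..}\<close> by (intro add_mono hausdorff_content_subtorus_le) auto
  also have "\<dots> = ennreal (2 * (\<Prod>i<m. a i))"
    using A by (simp add: ennreal_plus[symmetric] del: ennreal_plus)
  finally show "?c S \<le> ennreal (2 * (\<Prod>i<m. a i))" .
qed

section \<open>The angular coordinates of a flat torus\<close>

lemma cis_eq_imp_lattice:
  assumes "0 < a" "cis (2 * pi * x / a) = cis (2 * pi * y / a)"
  shows "\<exists>m::int. x - y = a * of_int m"
proof -
  have "sin (2 * pi * x / a) = sin (2 * pi * y / a) \<and> cos (2 * pi * x / a) = cos (2 * pi * y / a)"
    using assms(2) by (simp add: complex_eq_iff)
  then obtain m :: int where "2 * pi * x / a = 2 * pi * y / a + 2 * pi * m"
    using sin_cos_eq_iff by blast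
  then have "2 * pi * (x - y) = 2 * pi * (a * m)"
    using assms(1) by (simp add: field_simps)
  then show ?thesis by auto
qed

lemma lattice_imp_cis_eq:
  assumes "0 < a" "x - y = a * of_int m"
  shows "cis (2 * pi * x / a) = cis (2 * pi * y / a)"
proof -
  have "2 * pi * x / a = 2 * pi * y / a + 2 * pi * of_int m"
    using assms by (simp add: field_simps)
  then show ?thesis
    using sin_cos_eq_iff[of "2 * pi * x / a" "2 * pi * y / a"] by (auto simp: complex_eq_iff)
qed

lemma norm_cis_diff_le: "norm (cis s - cis t) \<le> \<bar>s - t\<bar>"
proof -
  have "cis s - cis t = cis t * (cis (s - t) - 1)"
    by (simp add: algebra_simps cis_mult)
  then have "norm (cis s - cis t) = norm (exp (\<i> * of_real (s - t)) - 1)"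
    by (simp add: norm_mult cis_conv_exp)
  also have "\<dots> = 2 * \<bar>sin ((s - t) / 2)\<bar>"
    by (rule dist_exp_i_1)
  also have "\<dots> \<le> 2 * \<bar>(s - t) / 2\<bar>"
    by (intro mult_left_mono abs_sin_x_le_abs_x) auto
  finally show ?thesis by simp
qed

text \<open>
  The \<open>i\<close>-th coordinate of a point of the torus, as a point of the unit circle; by \<open>phase_eq\<close> below the
  representative does not matter.
\<close>
definition phase :: "(nat \<Rightarrow> real) \<Rightarrow> nat \<Rightarrow> (nat \<Rightarrow> real) set \<Rightarrow> complex" where
  "phase a i p = cis (2 * pi * (SOME x. x \<in> p) i / a i)"

lemma phase_eq:
  assumes "0 < a i" "i < n" "p \<in> flat_torus n a" "x \<in> p"
  shows "phase a i p = cis (2 * pi * x i / a i)"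
proof -
  have "(SOME x. x \<in> p) \<in> p" using assms(4) by (rule someI[of "\<lambda>x. x \<in> p"])
  then obtain m :: int where "(SOME x. x \<in> p) i - x i = a i * m"
    using flat_torus_rel[OF assms(3)] assms lattice_relD by blast
  then show ?thesis unfolding phase_def using assms(1) by (rule lattice_imp_cis_eq[rotated])
qed

lemma norm_phase [simp]: "norm (phase a i p) = 1"
  by (simp add: phase_def)

text \<open>
  The Lipschitz bound holds for all representatives, since a chord is not longer than its arc, and hence
  for the infimum over them.
\<close>
lemma dist_phase_le:
  assumes "0 < a i" "i < n" and p: "p \<in> flat_torus n a" and q: "q \<in> flat_torus n a"
  shows "dist (phase a i p) (phase a i q) \<le> 2 * pi / a i * flat_dist n p q"
proof -
  have "a i / (2 * pi) * dist (phase a i p) (phase a i q) \<le> flat_dist n p q"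
  proof (rule flat_dist_greatest)
    show "p \<noteq> {}" "q \<noteq> {}" using flat_torus_nonempty p q by blast+
    fix x y assume x: "x \<in> p" and y: "y \<in> q"
    have "dist (phase a i p) (phase a i q) \<le> \<bar>2 * pi * x i / a i - 2 * pi * y i / a i\<bar>"
      using assms x y by (simp add: phase_eq dist_norm norm_cis_diff_le)
    also have "2 * pi * x i / a i - 2 * pi * y i / a i = 2 * pi / a i * (x i - y i)"
      by (simp add: right_diff_distrib)
    finally have "dist (phase a i p) (phase a i q) \<le> 2 * pi / a i * \<bar>x i - y i\<bar>"
      using assms(1) by (simp add: abs_mult)
    moreover have "\<bar>x i - y i\<bar> \<le> L2_set (\<lambda>i. x i - y i) {..<n}"
      using member_le_L2_set[of "{..<n}" i "\<lambda>i. \<bar>x i - y i\<bar>"] assms(2) by (simp add: L2_set_def)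
    ultimately show "a i / (2 * pi) * dist (phase a i p) (phase a i q) \<le> L2_set (\<lambda>i. x i - y i) {..<n}"
      using assms(1) by (simp add: field_simps) (smt (verit) mult_left_mono pi_gt_zero)
  qed
  then show ?thesis using assms(1) by (simp add: field_simps)
qed

lemma continuous_map_phase:
  assumes a: "\<And>i. i < n \<Longrightarrow> 0 < a i" and i: "i < n"
  shows "continuous_map (flat_torus_topology n a) euclidean (phase a i)"
proof -
  interpret Metric_space "flat_torus n a" "flat_dist n"
    by (rule Metric_space_flat_torus[OF a])
  have "\<exists>\<delta>>0. \<forall>q. q \<in> flat_torus n a \<and> flat_dist n p q < \<delta> \<longrightarrow> dist (phase a i p) (phase a i q) < \<epsilon>"
    if p: "p \<in> flat_torus n a" and "0 < \<epsilon>" for p \<epsilon>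
  proof (intro exI conjI allI impI)
    show "0 < \<epsilon> / (2 * pi / a i)" using \<open>0 < \<epsilon>\<close> a[OF i] by simp
    fix q assume q: "q \<in> flat_torus n a \<and> flat_dist n p q < \<epsilon> / (2 * pi / a i)"
    then have "2 * pi / a i * flat_dist n p q < \<epsilon>"
      using a[OF i] by (simp add: field_simps)
    then show "dist (phase a i p) (phase a i q) < \<epsilon>"
      using dist_phase_le[OF a[OF i] i p] q by fastforce
  qed
  then show ?thesis
    unfolding mtopology_is_euclidean[symmetric] metric_continuous_map[OF Met_TC.Metric_space_axioms]
    by blast
qed

section \<open>Folding a torus of dimension k into k-dimensional space\<close>

text \<open>
  The radius of the \<open>j\<close>-th revolution. Revolving by the angle of \<open>u (Suc j)\<close> turns \<open>radius u j\<close> into the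
  point \<open>radius u j * u (Suc j)\<close> of the complex plane. Its real part is kept as an output, and its
  imaginary part, made positive by the exponential, is the next radius.
\<close>
fun radius :: "(nat \<Rightarrow> complex) \<Rightarrow> nat \<Rightarrow> real" where
  "radius u 0 = exp (Re (u 0))"
| "radius u (Suc j) = exp (radius u j * Im (u (Suc j)))"

lemma radius_pos: "0 < radius u j"
  by (cases j) auto

text \<open>
  The revolutions are undone from the last to the first: the next radius gives the imaginary part of
  \<open>radius u j * u (Suc j)\<close>, the output gives its real part, and as \<open>radius u j\<close> is positive, it is
  the modulus of this complex number. What is left at the end is the real part of \<open>u 0\<close>.
\<close>
lemma radius_inj:
  assumes "\<And>j. norm (u j) = 1" "\<And>j. norm (v j) = 1"
    and "\<And>j. j < k \<Longrightarrow> radius u j * Re (u (Suc j)) = radius v j * Re (v (Suc j))"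
    and "radius u k = radius v k"
  shows "Re (u 0) = Re (v 0) \<and> (\<forall>j. 0 < j \<and> j \<le> k \<longrightarrow> u j = v j)"
  using assms(3,4)
proof (induction k)
  case (Suc k)
  have "of_real (radius u k) * u (Suc k) = of_real (radius v k) * v (Suc k)"
    using Suc.prems by (simp add: complex_eq_iff)
  moreover from this have "radius u k = radius v k"
    using assms(1,2) radius_pos[of u k] radius_pos[of v k]
    by (metis abs_of_pos mult.right_neutral norm_mult norm_of_real)
  ultimately have "u (Suc k) = v (Suc k)" "radius u k = radius v k"
    using radius_pos[of v k] by auto
  with Suc show ?case by (auto simp: le_Suc_eq)
qed simp

definition fold_coord :: "nat \<Rightarrow> (nat \<Rightarrow> complex) \<Rightarrow> nat \<Rightarrow> real" where
  "fold_coord k u j = (if Suc j < k then radius u j * Re (u (Suc j)) else radius u j)"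

text \<open>
  A point of the unit circle is determined by its real part up to conjugation. This is the source of the
  factor \<open>2\<close>.
\<close>
lemma fold_coord_fibre:
  assumes "1 \<le> k" "\<And>j. norm (u j) = 1" "\<And>j. norm (v j) = 1"
    and eq: "\<And>j. j < k \<Longrightarrow> fold_coord k u j = fold_coord k v j"
  shows "(u 0 = v 0 \<or> u 0 = cnj (v 0)) \<and> (\<forall>j. 0 < j \<and> j < k \<longrightarrow> u j = v j)"
proof -
  have "Re (u 0) = Re (v 0) \<and> (\<forall>j. 0 < j \<and> j \<le> k - 1 \<longrightarrow> u j = v j)"
  proof (rule radius_inj)
    show "radius u j * Re (u (Suc j)) = radius v j * Re (v (Suc j))" if "j < k - 1" for j
      using eq[of j] that by (simp add: fold_coord_def less_diff_conv)
    show "radius u (k - 1) = radius v (k - 1)"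
      using eq[of "k - 1"] \<open>1 \<le> k\<close> by (simp add: fold_coord_def)
  qed (use assms in auto)
  moreover have "(Im (u 0))\<^sup>2 = (Im (v 0))\<^sup>2" if "Re (u 0) = Re (v 0)"
    using assms(2,3)[of 0] that by (simp add: cmod_def)
  ultimately show ?thesis
    using \<open>1 \<le> k\<close> by (auto simp: complex_eq_iff power2_eq_iff)
qed

lemma continuous_map_fold_coord:
  assumes u: "\<And>i. i < k \<Longrightarrow> continuous_map X euclidean (\<lambda>p. u p i)" and "j < k"
  shows "continuous_map X euclideanreal (\<lambda>p. fold_coord k (u p) j)"
proof -
  have Re: "continuous_map X euclideanreal (\<lambda>p. Re (u p i))"
   and Im: "continuous_map X euclideanreal (\<lambda>p. Im (u p i))" if "i < k" for i
    using continuous_map_compose[OF u[OF that], of euclideanreal Re]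
      continuous_map_compose[OF u[OF that], of euclideanreal Im]
    by (auto simp: o_def continuous_on_Re continuous_on_Im continuous_on_id)
  have exp: "continuous_map X euclideanreal (\<lambda>p. exp (g p))"
    if "continuous_map X euclideanreal g" for g :: "_ \<Rightarrow> real"
    using continuous_map_compose[OF that, of euclideanreal exp]
    by (auto simp: o_def continuous_on_exp continuous_on_id)
  have rad: "continuous_map X euclideanreal (\<lambda>p. radius (u p) i)" if "i < k" for i
    using that by (induction i) (auto intro!: exp Re Im continuous_map_real_mult)
  show ?thesis
    unfolding fold_coord_def using \<open>j < k\<close>
    by (auto intro!: rad Re continuous_map_real_mult)
qed

definition fold_torus :: "nat \<Rightarrow> nat \<Rightarrow> (nat \<Rightarrow> real) \<Rightarrow> (nat \<Rightarrow> real) set \<Rightarrow> nat \<Rightarrow> real" where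
  "fold_torus m k a p = (\<lambda>j. if j < k then fold_coord k (\<lambda>i. phase a (m + i) p) j else 0)"

lemma continuous_map_fold_torus:
  assumes "\<And>i. i < m + k \<Longrightarrow> 0 < a i"
  shows "continuous_map (flat_torus_topology (m + k) a) (Euclidean_space k) (fold_torus m k a)"
  unfolding fold_torus_def
  by (subst continuous_map_componentwise_Euclidean_space)
    (auto intro!: continuous_map_fold_coord continuous_map_phase assms)

text \<open>
  Conjugating the \<open>m\<close>-th phase negates the \<open>m\<close>-th coordinate, so the two subtori are those through a
  point \<open>c\<close> of the fibre and through the reflection \<open>c'\<close> of \<open>c\<close> in that coordinate.
\<close>
lemma fold_torus_fibre:
  assumes a: "\<And>i. i < m + k \<Longrightarrow> 0 < a i" and "1 \<le> k"
  shows "\<exists>c c'. {p \<in> flat_torus (m + k) a. fold_torus m k a p = y}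
           \<subseteq> subtorus (m + k) a m c \<union> subtorus (m + k) a m c'"
proof (cases "{p \<in> flat_torus (m + k) a. fold_torus m k a p = y} = {}")
  case False
  then obtain q c where q: "q \<in> flat_torus (m + k) a" "fold_torus m k a q = y" and c: "c \<in> q"
    using flat_torus_nonempty by blast
  define c' where "c' = c(m := - c m)"
  have "p \<in> subtorus (m + k) a m c \<union> subtorus (m + k) a m c'"
    if p: "p \<in> flat_torus (m + k) a" "fold_torus m k a p = y" for p
  proof -
    obtain x where x: "x \<in> p" using flat_torus_nonempty p by blast
    let ?u = "\<lambda>j. phase a (m + j) p" and ?v = "\<lambda>j. phase a (m + j) q"
    have u: "?u j = cis (2 * pi * x (m + j) / a (m + j))"
     and v: "?v j = cis (2 * pi * c (m + j) / a (m + j))" if "j < k" for j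
      using that by (auto intro!: phase_eq[of _ _ "m + k"] a p(1) q(1) x c)
    have eq: "fold_coord k ?u j = fold_coord k ?v j" if "j < k" for j
      using fun_cong[OF p(2)[folded q(2)], of j] that by (simp add: fold_torus_def)
    have fib: "(?u 0 = ?v 0 \<or> ?u 0 = cnj (?v 0)) \<and> (\<forall>j. 0 < j \<and> j < k \<longrightarrow> ?u j = ?v j)"
      using \<open>1 \<le> k\<close> eq by (intro fold_coord_fibre) auto
    \<comment> \<open>Equal phases allow the coordinates from \<open>m\<close> on to be changed to those of \<open>b\<close> within the class \<open>p\<close>.\<close>
    have move: "p \<in> subtorus (m + k) a m b"
      if b: "\<And>j. j < k \<Longrightarrow> ?u j = cis (2 * pi * b (m + j) / a (m + j))" for b
    proof -
      define x' where "x' i = (if m \<le> i \<and> i < m + k then b i else x i)" for i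
      have "\<exists>l::int. x i - x' i = a i * of_int l" if "i < m + k" for i
      proof (cases "m \<le> i")
        case True
        then have "cis (2 * pi * x i / a i) = cis (2 * pi * b i / a i)"
          using b[of "i - m"] u[of "i - m"] that by simp
        then show ?thesis
          using cis_eq_imp_lattice[OF a[OF that]] True that by (simp add: x'_def)
      qed (auto simp: x'_def intro: exI[of _ 0])
      then have "(x, x') \<in> lattice_rel (m + k) a"
        using flat_torus_rel[OF p(1) x x]
        by (auto simp: lattice_rel_def topspace_Euclidean_space x'_def)
      then have "x' \<in> p" using flat_torus_closed[OF p(1) x] by blast
      then show ?thesis using p(1) by (auto simp: subtorus_def x'_def intro!: bexI[of _ x'])
    qed
    show ?thesis
    proof (cases "?u 0 = ?v 0")
      case True
      then have "?u j = ?v j" if "j < k" for j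
        using fib that by (cases "j = 0") auto
      then show ?thesis using move[of c] v by simp
    next
      case False
      then have "?u 0 = cis (2 * pi * c' (m + 0) / a (m + 0))"
        using fib v[of 0] \<open>1 \<le> k\<close> by (simp add: c'_def cis_cnj)
      then have "?u j = cis (2 * pi * c' (m + j) / a (m + j))" if "j < k" for j
        using fib v[of j] that by (cases "j = 0") (auto simp: c'_def)
      then show ?thesis using move[of c'] by simp
    qed
  qed
  then show ?thesis by blast
qed blast

theorem theorem4p2:
  fixes n k :: nat and a :: "nat \<Rightarrow> real"
  assumes "0 < a 0" and "mono_on {..<n} a" and "1 \<le> k" and "k \<le> n"
  shows "\<exists>f. continuous_map (flat_torus_topology n a) (Euclidean_space k) f \<and>
             (\<forall>y \<in> topspace (Euclidean_space k).
                hausdorff_measure (flat_torus n a) (flat_dist n) (n - k) {p \<in> flat_torus n a. f p = y}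
                  \<le> ennreal (2 * (\<Prod>i<n - k. a i)))"
proof -
  define m where "m = n - k"
  have n: "n = m + k" using \<open>k \<le> n\<close> by (simp add: m_def)
  have a: "0 < a i" if "i < m + k" for i
    using mono_onD[OF assms(2), of 0 i] that \<open>0 < a 0\<close> by (force simp: n)
  have "hausdorff_measure (flat_torus n a) (flat_dist n) m {p \<in> flat_torus n a. fold_torus m k a p = y}
          \<le> ennreal (2 * (\<Prod>i<m. a i))" for y
  proof -
    obtain c c' where fibre: "{p \<in> flat_torus n a. fold_torus m k a p = y}
        \<subseteq> subtorus n a m c \<union> subtorus n a m c'"
      using fold_torus_fibre[of m k a y, OF a \<open>1 \<le> k\<close>] unfolding n by blast
    show ?thesis
      by (rule hausdorff_measure_two_subtori_le[OF _ _ fibre]) (simp_all add: n a)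
  qed
  moreover have "continuous_map (flat_torus_topology n a) (Euclidean_space k) (fold_torus m k a)"
    unfolding n by (rule continuous_map_fold_torus[OF a])
  ultimately show ?thesis
    unfolding m_def[symmetric] by (intro exI[of _ "fold_torus m k a"] conjI ballI)
qed

end
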